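(* Let $T$ be a partially ordered set and $\mu$ a probability measure on $T$. Let $b,n\ge0$ and $i\ge1$ be integers. Then, almost surely, $$\lim_{b\to\infty}\frac{\#\{j\in[0,b): S_j^{<}\text{ occurs and }N_j^{<}=n\}}{\#\{j\in[0,b):S_j^{<}\text{ occurs}\}}=\mathbb{P}(N_i^{<}=n\mid S_i^{<})$$ and $$\lim_{b\to\infty}\frac{\#\{j\in[0,b): S_j^{\le}\text{ occurs and }N_j^{\le}=n\}}{\#\{j\in[0,b):S_j^{\le}\text{ occurs}\}}=\mathbb{P}(N_i^{\le}=n\mid S_i^{\le}),$$ where $j$ ranges over integers.
   Context: $T$ carries its Borel $\sigma$-algebra, on which measures on $T$ are defined, and it is assumed that $\{(x,y)\in T^2:x<y\}$ is measurable (so that the event $\{X_0<X_1\}$ below is measurable). Runs: $X_0,X_1,X_2,\dots$ are i.i.d. $T$-valued random variables with law $\mu$ on a probability space $(\Omega,\mathcal{F},\mathbb{P})$. For $i\ge0$, the event that a strict run begins at $i$ is $S_0^{<}=\Omega$ and $S_i^{<}=\{X_{i-1}\not< X_i\}$ for $i\ge1$; the event that a non-strict run begins at $i$ is $S_0^{\le}=\Omega$ and $S_i^{\le}=\{X_{i-1}\not\le X_i\}$ for $i\ge1$. The run length $N_i^{<}$ is defined only on $S_i^{<}$, with values in $\{1,2,\dots\}\cup\{\infty\}$: for finite $n\ge1$, $\{N_i^{<}=n\}=S_i^{<}\cap\{X_i<X_{i+1}<\dots<X_{i+n-1}\}\cap\{X_{i+n-1}\not<X_{i+n}\}$ (the chain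 condition being vacuous for $n=1$), and $\{N_i^{<}=\infty\}=S_i^{<}\cap\{X_i<X_{i+1}<\cdots\}$. $N_i^{\le}$ is defined on $S_i^{\le}$ in the same way with $<,\not<$ replaced by $\le,\not\le$.
   Formalization: The second limit (non-strict runs) is stated under the extra assumption that {(x,y): x≤y} is measurable in the product σ-algebra; measurability of {x<y} alone does not make {X_0≤X_1} an event, and the claim can then fail. *)

theory Defs
  imports "HOL-Probability.Probability" "HOL-Library.Extended_Nat"
begin

definition run_begins :: "('a \<Rightarrow> 'a \<Rightarrow> bool) \<Rightarrow> (nat \<Rightarrow> 'a) \<Rightarrow> nat \<Rightarrow> bool"
  where "run_begins R x i \<longleftrightarrow> i = 0 \<or> \<not> R (x (i - 1)) (x i)"

(* A run length is only meaningful at an i with run_begins R x i; elsewhere this total function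
   just counts the terms from position i on, so uses of it must be guarded by run_begins. *)
definition run_length :: "('a \<Rightarrow> 'a \<Rightarrow> bool) \<Rightarrow> (nat \<Rightarrow> 'a) \<Rightarrow> nat \<Rightarrow> enat"
  where "run_length R x i =
    (if \<forall>k. R (x (i + k)) (x (i + k + 1)) then \<infinity>
     else enat ((LEAST k. \<not> R (x (i + k)) (x (i + k + 1))) + 1))"

lemma run_length_eq_infinity_iff:
  "run_length R x i = \<infinity> \<longleftrightarrow> (\<forall>k. R (x (i + k)) (x (i + k + 1)))"
  by (simp add: run_length_def)

lemma run_length_eq_enat_iff:
  "run_length R x i = enat n \<longleftrightarrow>
     n \<ge> 1 \<and> (\<forall>k. k + 1 < n \<longrightarrow> R (x (i + k)) (x (i + k + 1))) \<and> \<not> R (x (i + n - 1)) (x (i + n))"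
    (is "?L \<longleftrightarrow> ?R")
proof
  assume L: ?L
  then obtain k where k: "\<not> R (x (i + k)) (x (i + k + 1))"
    by (auto simp: run_length_def split: if_splits)
  define m where "m = (LEAST k. \<not> R (x (i + k)) (x (i + k + 1)))"
  have n: "n = m + 1" using L k by (auto simp: run_length_def m_def split: if_splits)
  have "\<not> R (x (i + m)) (x (i + m + 1))" unfolding m_def by (rule LeastI) (rule k)
  moreover have "R (x (i + j)) (x (i + j + 1))" if "j < m" for j
    using not_less_Least[OF that[unfolded m_def]] by simp
  ultimately show ?R by (simp add: n)
next
  assume R: ?R
  then obtain m where n: "n = m + 1" by (metis add.commute le_Suc_ex)
  have m: "\<not> R (x (i + m)) (x (i + m + 1))" using R by (simp add: n)
  have "(LEAST k. \<not> R (x (i + k)) (x (i + k + 1))) = m"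
  proof (rule Least_equality)
    show "m \<le> y" if "\<not> R (x (i + y)) (x (i + y + 1))" for y
      using R that by (force simp: n not_less[symmetric])
  qed (rule m)
  with m show ?L by (auto simp: run_length_def n)
qed

end

(* Whether a run of length n begins at j >= 1 depends only on the window X_{j-1}, ..., X_{j+n}.
   Windows of length m at positions congruent modulo m are disjoint, hence independent, so
   Hoeffding's inequality on each residue class, a union bound over the m classes and
   Borel-Cantelli give a strong law of large numbers for window events. Numerator and denominator
   divided by b then converge almost surely to P(N_i = n, S_i) and P(S_i). *)

theory Submission
  imports Defs
begin

section \<open>Hoeffding bounds and a strong law along residue classes\<close>

context prob_space
begin

text \<open>Hoeffding's inequality for variables with range [0, 1]. The exponent uses the common
  bound \<open>b\<close> in place of \<open>card I\<close>, so that all residue classes below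
  \<open>b\<close> get the same estimate. An empty class gives the sum 0, which stays below
  \<open>e\<close>.\<close>

lemma prob_sum_deviation_le:
  fixes Y :: "nat \<Rightarrow> 'a \<Rightarrow> real"
  assumes indep: "indep_vars (\<lambda>_. borel) Y I" and fin: "finite I" and card: "card I \<le> b"
    and bounds: "\<And>j \<omega>. Y j \<omega> \<in> {0..1}"
    and mean: "\<And>j. j \<in> I \<Longrightarrow> expectation (Y j) = p"
    and e: "e > 0"
  shows "prob {\<omega> \<in> space M. \<bar>\<Sum>j\<in>I. Y j \<omega> - p\<bar> \<ge> e} \<le> 2 * exp (- 2 * e\<^sup>2 / real b)"
proof (cases "I = {}")
  case True
  then show ?thesis using e by simp
next
  case False
  with fin have pos: "card I > 0" by (simp add: card_gt_0_iff)
  interpret H: Hoeffding_ineq M I Y "\<lambda>_. 0" "\<lambda>_. 1" "\<Sum>j\<in>I. expectation (Y j)"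
    by unfold_locales (use fin indep bounds in auto)
  have "prob {\<omega> \<in> space M. \<bar>\<Sum>j\<in>I. Y j \<omega> - p\<bar> \<ge> e}
      = prob {\<omega> \<in> space M. \<bar>(\<Sum>j\<in>I. Y j \<omega>) - (\<Sum>j\<in>I. expectation (Y j))\<bar> \<ge> e}"
    using mean by (simp add: sum_subtractf)
  also have "\<dots> \<le> 2 * exp (- 2 * e\<^sup>2 / real (card I))"
    using H.Hoeffding_ineq_abs_ge[of e] e pos by simp
  also have "\<dots> \<le> 2 * exp (- 2 * e\<^sup>2 / real b)"
    using pos card by (auto intro!: divide_left_mono)
  finally show ?thesis .
qed

text \<open>Independence is asked only within each residue class modulo \<open>m\<close>; dependence
  between classes is absorbed by the union bound. The resulting tails decay exponentially in
  \<open>b\<close>, hence are summable as Borel-Cantelli requires.\<close>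

lemma AE_average_tendsto:
  fixes Y :: "nat \<Rightarrow> 'a \<Rightarrow> real"
  assumes m: "m > 0"
    and indep: "\<And>r. indep_vars (\<lambda>_. borel) Y {j. j mod m = r}"
    and bounds: "\<And>j \<omega>. Y j \<omega> \<in> {0..1}"
    and mean: "\<And>j. expectation (Y j) = p"
  shows "AE \<omega> in M. (\<lambda>b. (\<Sum>j<b. Y j \<omega>) / real b) \<longlonglongrightarrow> p"
proof -
  have [measurable]: "Y j \<in> borel_measurable M" for j
    using indep[of "j mod m"] by (auto simp: indep_vars_def)
  have dev: "AE \<omega> in M. \<forall>\<^sub>F b in sequentially. \<bar>\<Sum>j<b. Y j \<omega> - p\<bar> < d * real b" if d: "d > 0" for d
  proof -
    define B where "B b = {\<omega> \<in> space M. \<bar>\<Sum>j<b. Y j \<omega> - p\<bar> \<ge> d * real b}" for b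
    have B[measurable]: "B b \<in> events" for b
      unfolding B_def by measurable
    \<comment> \<open>With \<open>e = d * b / m\<close> below, the Hoeffding exponent
      \<open>2 * e^2 / b\<close> equals \<open>c * b\<close>, so the bound is geometric in
      \<open>b\<close>.\<close>
    define c where "c = 2 * (d / real m)\<^sup>2"
    have c: "c > 0" using d m by (simp add: c_def)
    have le: "prob (B b) \<le> 2 * real m * exp (- c) ^ b" if b: "b \<ge> 1" for b
    proof -
      \<comment> \<open>An equal share of the total deviation \<open>d * b\<close> for each of the
        \<open>m\<close> classes: if every class sum stays below its share, the whole sum stays
        below \<open>d * b\<close>.\<close>
      define e where "e = d * real b / real m"
      have e: "e > 0" using d b m by (simp add: e_def)
      define I where "I r = {j \<in> {..<b}. j mod m = r}" for r
      define C where "C r = {\<omega> \<in> space M. \<bar>\<Sum>j\<in>I r. Y j \<omega> - p\<bar> \<ge> e}" for r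
      have C: "C r \<in> events" for r
        unfolding C_def by measurable
      have "B b \<subseteq> (\<Union>r<m. C r)"
      proof
        fix \<omega> assume w: "\<omega> \<in> B b"
        show "\<omega> \<in> (\<Union>r<m. C r)"
        proof (rule ccontr)
          assume "\<omega> \<notin> (\<Union>r<m. C r)"
          then have small: "\<bar>\<Sum>j\<in>I r. Y j \<omega> - p\<bar> < e" if "r < m" for r
            using w that by (force simp: C_def B_def)
          have "(\<Sum>j<b. Y j \<omega> - p) = (\<Sum>r<m. \<Sum>j\<in>I r. Y j \<omega> - p)"
            unfolding I_def by (rule sum.group[symmetric]) (use m in auto)
          also have "\<bar>\<dots>\<bar> \<le> (\<Sum>r<m. \<bar>\<Sum>j\<in>I r. Y j \<omega> - p\<bar>)" by (rule sum_abs)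
          also have "\<dots> < (\<Sum>r<m. e)"
            using m small by (intro sum_strict_mono) auto
          also have "\<dots> = d * real b" using m by (simp add: e_def)
          finally show False using w by (simp add: B_def)
        qed
      qed
      then have "prob (B b) \<le> prob (\<Union>r<m. C r)"
        by (intro finite_measure_mono) (use C in auto)
      also have "\<dots> \<le> (\<Sum>r<m. prob (C r))"
        by (intro finite_measure_subadditive_finite) (use C in auto)
      also have "\<dots> \<le> (\<Sum>r<m. 2 * exp (- 2 * e\<^sup>2 / real b))"
        unfolding C_def
      proof (intro sum_mono prob_sum_deviation_le)
        show "indep_vars (\<lambda>_. borel) Y (I r)" for r
          by (rule indep_vars_subset[OF indep[of r]]) (auto simp: I_def)
        have "card (I r) \<le> card {..<b}" for r
          by (intro card_mono) (auto simp: I_def)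
        then show "card (I r) \<le> b" for r by simp
      qed (use bounds mean e in \<open>auto simp: I_def\<close>)
      also have "- 2 * e\<^sup>2 / real b = real b * - c"
        using b by (simp add: e_def c_def power2_eq_square)
      also have "exp (real b * - c) = exp (- c) ^ b"
        by (rule exp_of_nat_mult)
      finally show ?thesis by simp
    qed
    have "summable (\<lambda>b. prob (B b))"
    \<comment> \<open>At \<open>b = 0\<close> the threshold \<open>e\<close> vanishes, so the
      comparison starts at 1.\<close>
    proof (rule summable_comparison_test'[where N = 1])
      show "summable (\<lambda>b. 2 * real m * exp (- c) ^ b)"
        using c by (intro summable_mult summable_geometric) simp
    qed (use le in simp)
    then have "AE \<omega> in M. \<forall>\<^sub>F b in sequentially. \<omega> \<in> space M - B b"
      by (intro borel_cantelli_AE1) (auto simp: emeasure_eq_measure)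
    then show ?thesis
      by eventually_elim (auto simp: B_def not_le elim: eventually_mono)
  qed
  \<comment> \<open>Restricting to the tolerances \<open>1 / (k + 1)\<close> leaves countably many
    null sets, so one null set serves for all of them.\<close>
  have "AE \<omega> in M. \<forall>k. \<forall>\<^sub>F b in sequentially.
      \<bar>\<Sum>j<b. Y j \<omega> - p\<bar> < inverse (real (Suc k)) * real b"
    using dev by (subst AE_all_countable) simp
  then show ?thesis
  proof eventually_elim
    case (elim \<omega>)
    show ?case
    proof (rule tendstoI)
      fix \<epsilon> :: real assume "\<epsilon> > 0"
      then obtain k where k: "inverse (real (Suc k)) < \<epsilon>"
        using reals_Archimedean by blast
      show "\<forall>\<^sub>F b in sequentially. dist ((\<Sum>j<b. Y j \<omega>) / real b) p < \<epsilon>"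
        using elim[rule_format, of k] eventually_gt_at_top[of 0]
      proof eventually_elim
        case (elim b)
        have "(\<Sum>j<b. Y j \<omega>) / real b - p = (\<Sum>j<b. Y j \<omega> - p) / real b"
          using elim(2) by (simp add: sum_subtractf diff_divide_distrib)
        then have "dist ((\<Sum>j<b. Y j \<omega>) / real b) p = \<bar>\<Sum>j<b. Y j \<omega> - p\<bar> / real b"
          by (simp add: dist_real_def)
        also have "\<dots> < inverse (real (Suc k))"
          using elim by (simp add: pos_divide_less_eq)
        finally show ?case using k by simp
      qed
    qed
  qed
qed

section \<open>Windows of an i.i.d. sequence\<close>

context
  fixes X :: "nat \<Rightarrow> 'a \<Rightarrow> 'b" and N :: "'b measure" and m :: nat and G :: "(nat \<Rightarrow> 'b) \<Rightarrow> bool"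
  assumes indep: "indep_vars (\<lambda>_. N) X UNIV"
    and same: "\<And>k. distr M N (X k) = distr M N (X 0)"
    and m: "m > 0"
    and G[measurable]: "Measurable.pred (Pi\<^sub>M {..<m} (\<lambda>_. N)) G"
begin

text \<open>Indexing from 0 puts all windows into one product space, so that a single predicate
  \<open>G\<close> applies at every position.\<close>

private abbreviation "window j \<omega> \<equiv> (\<lambda>k\<in>{..<m}. X (j + k) \<omega>)"

private lemma X_measurable: "X k \<in> measurable M N"
  using indep by (auto simp: indep_vars_def)

private lemma window_measurable: "window j \<in> measurable M (Pi\<^sub>M {..<m} (\<lambda>_. N))"
  by (intro measurable_restrict X_measurable)

text \<open>Stationarity: by independence and equal marginals, every window has as its law the
  product of \<open>m\<close> copies of the law of \<open>X 0\<close>.\<close>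

lemma prob_window_eq: "prob {\<omega> \<in> space M. G (window j \<omega>)} = prob {\<omega> \<in> space M. G (window 0 \<omega>)}"
proof -
  note [measurable] = X_measurable window_measurable
  have distr: "distr M (Pi\<^sub>M {..<m} (\<lambda>_. N)) (window j) = Pi\<^sub>M {..<m} (\<lambda>_. distr M N (X 0))" for j
  proof -
    \<comment> \<open>Singleton blocks serve to reindex: they turn independence of \<open>X\<close>
      over all indices into independence of the shifted family \<open>X (j + k)\<close> over
      \<open>k < m\<close>.\<close>
    have "indep_vars (\<lambda>k. Pi\<^sub>M {j + k} (\<lambda>_. N)) (\<lambda>k \<omega>. \<lambda>i\<in>{j + k}. X i \<omega>) {..<m}"
      by (rule indep_vars_restrict[OF indep]) (auto simp: disjoint_family_on_def)
    then have "indep_vars (\<lambda>_. N) (\<lambda>k \<omega>. (\<lambda>i\<in>{j + k}. X i \<omega>) (j + k)) {..<m}"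
      by (rule indep_vars_compose2) simp
    then have "indep_vars (\<lambda>_. N) (\<lambda>k. X (j + k)) {..<m}" by simp
    then have "distr M (Pi\<^sub>M {..<m} (\<lambda>_. N)) (window j) = Pi\<^sub>M {..<m} (\<lambda>k. distr M N (X (j + k)))"
      using m by (subst (asm) indep_vars_iff_distr_eq_PiM) auto
    then show ?thesis by (simp add: same[of "j + _"])
  qed
  have "prob {\<omega> \<in> space M. G (window j \<omega>)}
      = measure (distr M (Pi\<^sub>M {..<m} (\<lambda>_. N)) (window j)) {z \<in> space (Pi\<^sub>M {..<m} (\<lambda>_. N)). G z}" for j
    by (subst measure_distr)
      (auto intro!: arg_cong[where f = prob] dest: measurable_space[OF window_measurable])
  then show ?thesis unfolding distr by metis
qed

lemma AE_window_frequency: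
  "AE \<omega> in M. (\<lambda>b. real (card {j \<in> {..<b}. G (window j \<omega>)}) / real b)
     \<longlonglongrightarrow> prob {\<omega> \<in> space M. G (window 0 \<omega>)}"
proof -
  note [measurable] = window_measurable
  define Y where "Y j \<omega> = (of_bool (G (window j \<omega>)) :: real)" for j \<omega>
  have "AE \<omega> in M. (\<lambda>b. (\<Sum>j<b. Y j \<omega>) / real b) \<longlonglongrightarrow> prob {\<omega> \<in> space M. G (window 0 \<omega>)}"
  proof (rule AE_average_tendsto[OF m])
    fix r
    \<comment> \<open>Grouping into blocks keeps the absolute indices \<open>{j..<j + m}\<close>;
      \<open>shift j\<close> moves such a block back to \<open>{..<m}\<close>, where
      \<open>G\<close> is defined.\<close>
    define shift :: "nat \<Rightarrow> (nat \<Rightarrow> 'b) \<Rightarrow> nat \<Rightarrow> 'b" where "shift j z = (\<lambda>k\<in>{..<m}. z (j + k))" for j z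
    \<comment> \<open>The starts of two overlapping windows differ by less than \<open>m\<close>; a
      multiple of \<open>m\<close> that small is 0.\<close>
    have overlap: "j = j'" if "j mod m = j' mod m" "i \<in> {j..<j + m}" "i \<in> {j'..<j' + m}" for i j j' :: nat
    proof -
      have *: "j = j'" if "j \<le> j'" "j mod m = j' mod m" "j' < j + m" for j j' :: nat
      proof -
        have "m dvd j' - j" using that by (metis mod_eq_dvd_iff_nat)
        with that show ?thesis using dvd_imp_le[of m "j' - j"] by linarith
      qed
      show ?thesis using that *[of j j'] *[of j' j] by force
    qed
    have "{j..<j + m} \<inter> {j'..<j' + m} = {}" if "j mod m = j' mod m" "j \<noteq> j'" for j j'
      using overlap that by blast
    then have "indep_vars (\<lambda>j. Pi\<^sub>M {j..<j + m} (\<lambda>_. N)) (\<lambda>j \<omega>. \<lambda>i\<in>{j..<j + m}. X i \<omega>) {j. j mod m = r}"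
      by (intro indep_vars_restrict[OF indep]) (simp_all add: disjoint_family_on_def)
    then have "indep_vars (\<lambda>_. borel)
        (\<lambda>j \<omega>. of_bool (G (shift j (\<lambda>i\<in>{j..<j + m}. X i \<omega>))) :: real) {j. j mod m = r}"
    proof (rule indep_vars_compose2)
      fix j
      have [measurable]: "shift j \<in> measurable (Pi\<^sub>M {j..<j + m} (\<lambda>_. N)) (Pi\<^sub>M {..<m} (\<lambda>_. N))"
        unfolding shift_def by (intro measurable_restrict measurable_component_singleton) auto
      show "(\<lambda>z. of_bool (G (shift j z))) \<in> borel_measurable (Pi\<^sub>M {j..<j + m} (\<lambda>_. N))"
        by measurable
    qed
    moreover have "shift j (\<lambda>i\<in>{j..<j + m}. X i \<omega>) = window j \<omega>" for j \<omega>
      by (auto simp: shift_def fun_eq_iff)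
    ultimately show "indep_vars (\<lambda>_. borel) Y {j. j mod m = r}"
      by (simp add: Y_def[abs_def])
  next
    fix j
    have "expectation (Y j) = expectation (indicator {\<omega> \<in> space M. G (window j \<omega>)})"
      by (intro Bochner_Integration.integral_cong) (auto simp: Y_def indicator_def)
    also have "\<dots> = prob {\<omega> \<in> space M. G (window j \<omega>)}"
      by simp
    also have "\<dots> = prob {\<omega> \<in> space M. G (window 0 \<omega>)}" by (rule prob_window_eq)
    finally show "expectation (Y j) = prob {\<omega> \<in> space M. G (window 0 \<omega>)}" .
  qed (auto simp: Y_def)
  then show ?thesis by (simp add: Y_def sum.inter_filter[symmetric] of_bool_def Int_def)
qed

end

section \<open>Frequencies of runs for an arbitrary measurable relation\<close>

lemma AE_run_frequency:
  fixes X :: "nat \<Rightarrow> 'a \<Rightarrow> 'b"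
  assumes indep: "indep_vars (\<lambda>_. N) X UNIV"
    and same: "\<And>k. distr M N (X k) = distr M N (X 0)"
    and R: "{(x, y). R x y} \<in> sets (N \<Otimes>\<^sub>M N)"
    and i: "i \<ge> 1"
  shows "AE \<omega> in M.
      (\<lambda>b. real (card {j \<in> {0..<b}. run_begins R (\<lambda>k. X k \<omega>) j \<and> run_length R (\<lambda>k. X k \<omega>) j = enat n})
          / real (card {j \<in> {0..<b}. run_begins R (\<lambda>k. X k \<omega>) j}))
      \<longlonglongrightarrow> cond_prob M (\<lambda>\<omega>. run_length R (\<lambda>k. X k \<omega>) i = enat n) (\<lambda>\<omega>. run_begins R (\<lambda>k. X k \<omega>) i)"
proof -
  \<comment> \<open>A window holds the predecessor of the run at index 0, the \<open>n\<close> terms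
    of the run at 1 to \<open>n\<close>, and the term that breaks it at
    \<open>n + 1\<close>.\<close>
  define m where "m = n + 2"
  define D where "D z \<longleftrightarrow> \<not> R (z 0) (z 1)" for z :: "nat \<Rightarrow> 'b"
  \<comment> \<open>Quantifying over a finite set makes measurability a matter of finite
    intersections. For \<open>n = 0\<close> the conjunct \<open>n \<ge> 1\<close> makes the event
    empty.\<close>
  define A where "A z \<longleftrightarrow> D z \<and> n \<ge> 1 \<and> (\<forall>k\<in>{k. k + 1 < n}. R (z (k + 1)) (z (k + 2))) \<and>
      \<not> R (z n) (z (n + 1))" for z :: "nat \<Rightarrow> 'b"
  define W where "W j \<omega> = (\<lambda>k\<in>{..<m}. X (j + k) \<omega>)" for j \<omega>
  have m: "m > 0" by (simp add: m_def)
  have [measurable]: "X k \<in> measurable M N" for k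
    using indep by (auto simp: indep_vars_def)
  have R_pred: "Measurable.pred (Pi\<^sub>M {..<m} (\<lambda>_. N)) (\<lambda>z. R (z k) (z l))" if "k < m" "l < m" for k l
  proof -
    have "(\<lambda>z. (z k, z l)) \<in> measurable (Pi\<^sub>M {..<m} (\<lambda>_. N)) (N \<Otimes>\<^sub>M N)"
      using that by (intro measurable_Pair measurable_component_singleton) auto
    from measurable_sets[OF this R] show ?thesis
      by (simp add: pred_def vimage_def Int_def conj_commute)
  qed
  have D: "Measurable.pred (Pi\<^sub>M {..<m} (\<lambda>_. N)) D"
    unfolding D_def by (intro pred_intros_logic R_pred) (auto simp: m_def)
  have A: "Measurable.pred (Pi\<^sub>M {..<m} (\<lambda>_. N)) A"
    unfolding A_def
    by (intro pred_intros_logic pred_intros_finite D R_pred)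
      (auto simp: m_def intro: finite_subset[of _ "{..n}"])
  \<comment> \<open>The window at \<open>j\<close> starts with the predecessor, so it describes a
    run beginning at \<open>Suc j\<close>.\<close>
  have begins: "run_begins R (\<lambda>k. X k \<omega>) (Suc j) \<longleftrightarrow> D (W j \<omega>)" for j \<omega>
    by (simp add: run_begins_def D_def W_def m_def)
  have lengths: "run_begins R (\<lambda>k. X k \<omega>) (Suc j) \<and> run_length R (\<lambda>k. X k \<omega>) (Suc j) = enat n
      \<longleftrightarrow> A (W j \<omega>)" for j \<omega>
    unfolding begins run_length_eq_enat_iff A_def
    by (cases n) (auto simp: W_def m_def)
  define q where "q = prob {\<omega> \<in> space M. D (W 0 \<omega>)}"
  define p where "p = prob {\<omega> \<in> space M. A (W 0 \<omega>)}"
  \<comment> \<open>At position 0 a run begins with certainty rather than with probability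
    \<open>q\<close>. For \<open>i \<ge> 1\<close> the events are window events at
    \<open>i'\<close>, and stationarity moves them to the window at 0.\<close>
  obtain i' where i': "i = Suc i'" using i by (cases i) auto
  have cond: "cond_prob M (\<lambda>\<omega>. run_length R (\<lambda>k. X k \<omega>) i = enat n) (\<lambda>\<omega>. run_begins R (\<lambda>k. X k \<omega>) i) = p / q"
    using prob_window_eq[OF indep same m D, of i'] prob_window_eq[OF indep same m A, of i']
    unfolding cond_prob_def p_def q_def i' W_def[symmetric] lengths[symmetric] begins[symmetric]
    by (simp add: conj_commute)
  show ?thesis
  proof (cases "q = 0")
    \<comment> \<open>Both sides are 0: almost surely the only run is infinite, and \<^term>\<open>p / q\<close> divides by 0.\<close>
    case True
    have "AE \<omega> in M. \<not> D (W j \<omega>)" for j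
    proof -
      have "{\<omega> \<in> space M. D (W j \<omega>)} \<in> events"
        using D unfolding W_def by measurable
      moreover have "prob {\<omega> \<in> space M. D (W j \<omega>)} = 0"
        using True prob_window_eq[OF indep same m D, of j] by (simp add: q_def W_def)
      ultimately show ?thesis
        by (intro AE_I[where N = "{\<omega> \<in> space M. D (W j \<omega>)}"]) (auto simp: emeasure_eq_measure)
    qed
    then have "AE \<omega> in M. \<forall>j. \<not> D (W j \<omega>)" by (subst AE_all_countable) simp
    then show ?thesis
    proof eventually_elim
      case (elim \<omega>)
      then have "R (X j \<omega>) (X (Suc j) \<omega>)" for j
        by (auto simp: D_def W_def m_def)
      then have "run_length R (\<lambda>k. X k \<omega>) j = \<infinity>" for j
        by (simp add: run_length_eq_infinity_iff)
      then show ?case using True unfolding cond by simp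
    qed
  next
    case False
    \<comment> \<open>Position 0 has no predecessor and hence no window. It adds at most 1 to a
      count, which vanishes after division by \<open>b\<close>.\<close>
    have shift: "real (card {j \<in> {0..<Suc b}. P j}) / real b
        = of_bool (P 0) / real b + real (card {j \<in> {..<b}. P (Suc j)}) / real b" for P b
    proof -
      have "{j \<in> {0..<Suc b}. P j} = (if P 0 then {0} else {}) \<union> Suc ` {j \<in> {..<b}. P (Suc j)}"
        by (auto simp: less_Suc_eq_0_disj)
      then show ?thesis
        by (auto simp: card_image card_insert_disjoint add_divide_distrib)
    qed
    have lim: "(\<lambda>b. real (card {j \<in> {0..<Suc b}. P j}) / real b) \<longlonglongrightarrow> l"
      if "(\<lambda>b. real (card {j \<in> {..<b}. P (Suc j)}) / real b) \<longlonglongrightarrow> l" for P and l :: real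
      unfolding shift using tendsto_add[OF lim_const_over_n[of "of_bool (P 0)"] that] by simp
    from AE_window_frequency[OF indep same m D] AE_window_frequency[OF indep same m A] show ?thesis
      unfolding W_def[symmetric] p_def[symmetric] q_def[symmetric] cond
    proof eventually_elim
      case (elim \<omega>)
      let ?num = "\<lambda>b. real (card {j \<in> {0..<b}. run_begins R (\<lambda>k. X k \<omega>) j \<and> run_length R (\<lambda>k. X k \<omega>) j = enat n})"
      let ?den = "\<lambda>b. real (card {j \<in> {0..<b}. run_begins R (\<lambda>k. X k \<omega>) j})"
      have "(\<lambda>b. ?num (Suc b) / real b) \<longlonglongrightarrow> p"
        by (rule lim) (use elim(2) in \<open>simp only: lengths\<close>)
      moreover have "(\<lambda>b. ?den (Suc b) / real b) \<longlonglongrightarrow> q"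
        by (rule lim) (use elim(1) in \<open>simp only: begins\<close>)
      \<comment> \<open>Numerator and denominator are both scaled by the same \<open>b\<close>,
        which cancels once \<open>b > 0\<close>; the limit of the quotient exists because
        \<open>q\<close> is nonzero here.\<close>
      ultimately have "(\<lambda>b. (?num (Suc b) / real b) / (?den (Suc b) / real b)) \<longlonglongrightarrow> p / q"
        using False by (rule tendsto_divide)
      then have "(\<lambda>b. ?num (Suc b) / ?den (Suc b)) \<longlonglongrightarrow> p / q"
        by (rule Lim_transform_eventually)
          (use eventually_gt_at_top[of 0] in eventually_elim, simp)
      then show "(\<lambda>b. ?num b / ?den b) \<longlonglongrightarrow> p / q"
        by (rule LIMSEQ_imp_Suc)
    qed
  qed
qed

end

text \<open>The non-strict half carries its own measurability premise, since the diagonal may fail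
  to be measurable: on a two-point indiscrete space with the trivial order, \<open><\<close> is
  empty, while \<open>\<le>\<close> is the diagonal and lies outside the product
  sigma-algebra.\<close>

theorem theorem7:
  fixes M :: "'w measure"
    and \<mu> :: "'a :: {order, topological_space} measure"
    and X :: "nat \<Rightarrow> 'w \<Rightarrow> 'a"
    and n i :: nat
  assumes "prob_space M"
    and "prob_space \<mu>" and "sets \<mu> = sets borel"
    and "{(x, y). x < y} \<in> sets (borel \<Otimes>\<^sub>M borel :: ('a \<times> 'a) measure)"
    and "prob_space.indep_vars M (\<lambda>_. borel) X UNIV"
    and "\<And>k. distr M borel (X k) = \<mu>"
    and "i \<ge> 1"
  shows "(AE \<omega> in M.
      (\<lambda>b. real (card {j \<in> {0..<b}. run_begins (<) (\<lambda>k. X k \<omega>) j \<and>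
                                     run_length (<) (\<lambda>k. X k \<omega>) j = enat n})
          / real (card {j \<in> {0..<b}. run_begins (<) (\<lambda>k. X k \<omega>) j}))
      \<longlonglongrightarrow> cond_prob M (\<lambda>\<omega>. run_length (<) (\<lambda>k. X k \<omega>) i = enat n)
                      (\<lambda>\<omega>. run_begins (<) (\<lambda>k. X k \<omega>) i))
    \<and> ({(x, y). x \<le> y} \<in> sets (borel \<Otimes>\<^sub>M borel :: ('a \<times> 'a) measure) \<longrightarrow>
      (AE \<omega> in M.
      (\<lambda>b. real (card {j \<in> {0..<b}. run_begins (\<le>) (\<lambda>k. X k \<omega>) j \<and>
                                     run_length (\<le>) (\<lambda>k. X k \<omega>) j = enat n})
          / real (card {j \<in> {0..<b}. run_begins (\<le>) (\<lambda>k. X k \<omega>) j}))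
      \<longlonglongrightarrow> cond_prob M (\<lambda>\<omega>. run_length (\<le>) (\<lambda>k. X k \<omega>) i = enat n)
                      (\<lambda>\<omega>. run_begins (\<le>) (\<lambda>k. X k \<omega>) i)))"
proof -
  interpret prob_space M by fact
  have same: "distr M borel (X k) = distr M borel (X 0)" for k
    using assms(6) by simp
  show ?thesis
    by (intro conjI impI AE_run_frequency[OF assms(5) same _ assms(7)] assms(4)) assumption
qed

end
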